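(* For every positive integer $n$ the sequence $(h_{n,k})_{1\le k\le n}$ is log-concave.
   Context: A finite sequence of positive real numbers $(a_k)$ is log-concave if $a_{k-1}a_{k+1}\le a_k^2$ for all indices $k$ such that $k-1$, $k$, $k+1$ are all in the index range. A Standard Young Tableau (SYT) of size $n$ is a filling of the boxes of a Ferrers diagram (English notation, left- and top-justified) with $n$ boxes by $1,\dots,n$, each used once, increasing along rows and down columns. A SYT is called a hook if it consists of exactly one row and one column, i.e. its shape is $(k,1,1,\dots,1)$ for some $k\ge1$ (with $n-k\ge 0$ parts equal to $1$ after the first part). $h_{n,k}$ is the number of hooks of size $n$ whose first row has length $k$. *)

theory Defs
  imports Complex_Main "HOL-Library.FuncSet"
begin

text \<open>A finite sequence of positive reals, indexed by the interval from \<open>m\<close> to \<open>n\<close>.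
  For \<open>k\<close> strictly between \<open>m\<close> and \<open>n\<close> the natural subtraction \<open>k - 1\<close> does not truncate.\<close>

definition log_concave :: "nat \<Rightarrow> nat \<Rightarrow> (nat \<Rightarrow> real) \<Rightarrow> bool" where
  "log_concave m n a \<longleftrightarrow>
     (\<forall>k\<in>{m..n}. 0 < a k) \<and>
     (\<forall>k\<in>{m<..<n}. a (k - 1) * a (k + 1) \<le> (a k)\<^sup>2)"

definition partition_of :: "nat \<Rightarrow> nat list \<Rightarrow> bool" where
  "partition_of n lam \<longleftrightarrow> sorted_wrt (\<ge>) lam \<and> 0 \<notin> set lam \<and> sum_list lam = n"

text \<open>Boxes are pairs (row, column), counted from zero at the top left corner.\<close>

definition boxes :: "nat list \<Rightarrow> (nat \<times> nat) set" where
  "boxes lam = {(i, j). i < length lam \<and> j < lam ! i}"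

text \<open>A tableau is a pair of a shape and a filling. The filling is extensional on the boxes,
  so that every tableau is represented exactly once.\<close>

type_synonym tableau = "nat list \<times> (nat \<times> nat \<Rightarrow> nat)"

definition SYT :: "nat \<Rightarrow> tableau set" where
  "SYT n = {(lam, T).
     partition_of n lam \<and>
     T \<in> extensional (boxes lam) \<and>
     bij_betw T (boxes lam) {1..n} \<and>
     (\<forall>i j j'. (i, j) \<in> boxes lam \<and> (i, j') \<in> boxes lam \<and> j < j' \<longrightarrow> T (i, j) < T (i, j')) \<and>
     (\<forall>i i' j. (i, j) \<in> boxes lam \<and> (i', j) \<in> boxes lam \<and> i < i' \<longrightarrow> T (i, j) < T (i', j))}"

definition hook_shape :: "nat list \<Rightarrow> bool" where
  "hook_shape lam \<longleftrightarrow> (\<exists>k\<ge>1. \<exists>m. lam = k # replicate m 1)"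

definition hooks :: "nat \<Rightarrow> tableau set" where
  "hooks n = {(lam, T). (lam, T) \<in> SYT n \<and> hook_shape lam}"

definition hook_count :: "nat \<Rightarrow> nat \<Rightarrow> nat" where
  "hook_count n k = card {(lam, T). (lam, T) \<in> hooks n \<and> hd lam = k}"

end

theory Submission
  imports Defs "HOL-Library.Infinite_Set"
begin

text \<open>
  A hook tableau is determined by the set of entries in its arm, the first row without the
  corner. The corner holds the least entry \<open>1\<close>; the remaining entries \<open>2, \<dots>, n\<close> are divided
  between arm and leg, and each part can be arranged in increasing order in one way only.
  No box of the arm is comparable to a box of the leg, so every division is admissible. Hence
  \<open>h\<^bsub>n,k\<^esub>\<close> counts the \<open>(k - 1)\<close>-element subsets of \<open>{2..n}\<close>
  (\<open>hook_count_eq_binomial\<close>), and the claim is the log-concavity of a row of Pascal's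
  triangle. That follows since the ratio of consecutive binomial coefficients
  \<open>(m choose (j + 1)) / (m choose j) = (m - j) / (j + 1)\<close> decreases in \<open>j\<close>
  (\<open>binomial_row_log_concave\<close>).
\<close>

section \<open>Log-concavity of the rows of Pascal's triangle\<close>

text \<open>
  Clearing denominators in the ratios of neighbouring coefficients avoids division: with
  \<open>m = j + d + 2\<close>, the claim reduces to \<open>(j + 1) (d + 1) \<le> (j + 2) (d + 2)\<close>.
\<close>

lemma binomial_row_log_concave:
  assumes "Suc j < m"
  shows "(m choose j) * (m choose Suc (Suc j)) \<le> (m choose Suc j)\<^sup>2"
proof -
  define x y z where "x = m choose j" and "y = m choose Suc j" and "z = m choose Suc (Suc j)"
  obtain d where d: "m = j + d + 2"
    using assms by (metis add.commute add_2_eq_Suc less_iff_Suc_add add_Suc)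
  have step: "Suc i * (m choose Suc i) = (m - i) * (m choose i)" for i
    by (simp only: binomial_absorption binomial_absorb_comp)
  have yx: "(j + 1) * y = (d + 2) * x" and zy: "(j + 2) * z = (d + 1) * y"
    using step[of j] step[of "Suc j"] by (simp_all add: x_def y_def z_def d)
  have "(d + 2) * (j + 2) * (x * z) = ((d + 2) * x) * ((j + 2) * z)"
    by (simp only: ac_simps)
  also have "\<dots> = ((j + 1) * y) * ((d + 1) * y)"
    by (simp only: yx zy)
  also have "\<dots> = (j + 1) * (d + 1) * y\<^sup>2"
    by (simp only: power2_eq_square ac_simps)
  also have "\<dots> \<le> (d + 2) * (j + 2) * y\<^sup>2"
    by (intro mult_right_mono) (simp_all add: algebra_simps)
  finally have "x * z \<le> y\<^sup>2"
    by (simp del: add_2_eq_Suc add_2_eq_Suc')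
  then show ?thesis
    by (simp add: x_def y_def z_def)
qed

section \<open>Increasing enumerations\<close>

lemma strict_mono_on_image_unique:
  fixes f g :: "nat \<Rightarrow> 'a::linorder"
  assumes "strict_mono_on {..<c} f" "strict_mono_on {..<c} g" "f ` {..<c} = g ` {..<c}" "i < c"
  shows "f i = g i"
proof -
  have sorted: "sorted_wrt (<) (map h [0..<c])" if "strict_mono_on {..<c} h" for h :: "nat \<Rightarrow> 'a"
    using that by (auto simp: sorted_wrt_iff_nth_less strict_mono_on_def)
  have "map f [0..<c] = map g [0..<c]"
    using assms(3) by (intro strict_sorted_equal sorted assms) (simp add: atLeast0LessThan)
  then show ?thesis
    using \<open>i < c\<close> by simp
qed

lemma image_enumerate:
  fixes A :: "nat set"
  assumes "finite A"
  shows "enumerate A ` {..<card A} = A"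
  using finite_bij_enumerate[OF assms] by (simp add: bij_betw_def)

lemma enumerate_unique:
  fixes f :: "nat \<Rightarrow> nat"
  assumes "strict_mono_on {..<c} f" "i < c"
  shows "f i = enumerate (f ` {..<c}) i"
proof -
  have card: "card (f ` {..<c}) = c"
    by (simp add: card_image strict_mono_on_imp_inj_on assms)
  have "strict_mono_on {..<c} (enumerate (f ` {..<c}))"
    by (auto simp: strict_mono_on_def card intro!: finite_enumerate_mono)
  moreover have "enumerate (f ` {..<c}) ` {..<c} = f ` {..<c}"
    using image_enumerate[of "f ` {..<c}"] by (simp add: card)
  ultimately show ?thesis
    using assms strict_mono_on_image_unique by blast
qed

section \<open>Fillings of a hook\<close>

definition hook :: "nat \<Rightarrow> nat \<Rightarrow> nat list" where
  "hook a b = Suc a # replicate b 1"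

definition arm_box :: "nat \<Rightarrow> nat \<times> nat" where
  "arm_box j = (0, Suc j)"

definition leg_box :: "nat \<Rightarrow> nat \<times> nat" where
  "leg_box i = (Suc i, 0)"

lemma boxes_hook: "boxes (hook a b) = insert (0, 0) (arm_box ` {..<a} \<union> leg_box ` {..<b})"
proof -
  have "(i, j) \<in> boxes (hook a b) \<longleftrightarrow>
      (i, j) \<in> insert (0, 0) (arm_box ` {..<a} \<union> leg_box ` {..<b})" for i j
    by (cases i; cases j) (auto simp: boxes_def hook_def arm_box_def leg_box_def)
  then show ?thesis
    by auto
qed

lemma partition_of_hook: "partition_of (a + b + 1) (hook a b)"
proof -
  have "sorted_wrt (\<ge>) (replicate b (1::nat))"
    by (induction b) auto
  then show ?thesis
    by (auto simp: hook_def partition_of_def sum_list_replicate)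
qed

text \<open>
  Arm and leg meet only in the corner, so the row and column conditions split into
  monotonicity along each of the two and the requirement that both start above the corner.
\<close>

lemma SYT_hook_iff:
  "(hook a b, T) \<in> SYT (a + b + 1) \<longleftrightarrow>
     T \<in> extensional (boxes (hook a b)) \<and>
     bij_betw T (boxes (hook a b)) {1..a + b + 1} \<and>
     (\<forall>j<a. T (0, 0) < T (arm_box j)) \<and> (\<forall>i<b. T (0, 0) < T (leg_box i)) \<and>
     strict_mono_on {..<a} (T \<circ> arm_box) \<and> strict_mono_on {..<b} (T \<circ> leg_box)"
proof -
  have rows: "(\<forall>i j j'. (i, j) \<in> boxes (hook a b) \<and> (i, j') \<in> boxes (hook a b) \<and> j < j'
        \<longrightarrow> T (i, j) < T (i, j'))
      \<longleftrightarrow> (\<forall>j<a. T (0, 0) < T (arm_box j)) \<and> strict_mono_on {..<a} (T \<circ> arm_box)"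
    unfolding boxes_hook strict_mono_on_def
    by (fastforce simp: arm_box_def leg_box_def)
  have cols: "(\<forall>i i' j. (i, j) \<in> boxes (hook a b) \<and> (i', j) \<in> boxes (hook a b) \<and> i < i'
        \<longrightarrow> T (i, j) < T (i', j))
      \<longleftrightarrow> (\<forall>i<b. T (0, 0) < T (leg_box i)) \<and> strict_mono_on {..<b} (T \<circ> leg_box)"
    unfolding boxes_hook strict_mono_on_def
    by (fastforce simp: arm_box_def leg_box_def)
  show ?thesis
    using partition_of_hook by (auto simp: SYT_def rows cols)
qed

definition hook_filling :: "nat \<Rightarrow> nat \<Rightarrow> nat set \<Rightarrow> nat \<times> nat \<Rightarrow> nat" where
  "hook_filling a b A = restrict
     (\<lambda>(i, j). if i = 0 then (if j = 0 then 1 else enumerate A (j - 1))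
               else enumerate ({2..a + b + 1} - A) (i - 1))
     (boxes (hook a b))"

lemma hook_filling_simps:
  "hook_filling a b A (0, 0) = 1"
  "j < a \<Longrightarrow> hook_filling a b A (arm_box j) = enumerate A j"
  "i < b \<Longrightarrow> hook_filling a b A (leg_box i) = enumerate ({2..a + b + 1} - A) i"
  by (auto simp: hook_filling_def boxes_hook arm_box_def leg_box_def)

lemma hook_filling_arm:
  assumes "A \<subseteq> {2..a + b + 1}" "card A = a"
  shows "(hook_filling a b A \<circ> arm_box) ` {..<a} = A"
  using assms image_enumerate[of A] by (auto simp: hook_filling_simps finite_subset image_def)

text \<open>
  Every \<open>a\<close>-element set \<open>A\<close> of non-minimal entries is admissible as an arm: the enumerations
  of \<open>A\<close> and of its complement increase, and both stay above the corner entry \<open>1\<close>.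
\<close>

lemma hook_filling_SYT:
  assumes A: "A \<subseteq> {2..a + b + 1}" "card A = a"
  shows "(hook a b, hook_filling a b A) \<in> SYT (a + b + 1)"
proof -
  define L where "L = {2..a + b + 1} - A"
  let ?T = "hook_filling a b A"
  have fin: "finite A" "finite L"
    using A finite_subset by (auto simp: L_def)
  have card_L: "card L = b"
    using A by (simp add: L_def card_Diff_subset fin)
  have arm: "?T (arm_box j) = enumerate A j" "enumerate A j \<in> A" if "j < a" for j
    using that A fin by (auto simp: hook_filling_simps finite_enumerate_in_set)
  have leg: "?T (leg_box i) = enumerate L i" "enumerate L i \<in> L" if "i < b" for i
    using that card_L fin hook_filling_simps(3)[of i b a A, folded L_def]
    by (auto simp: finite_enumerate_in_set)
  have "?T ` boxes (hook a b) = insert 1 (A \<union> L)"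
  proof -
    have "?T ` arm_box ` {..<a} = A"
      using hook_filling_arm[OF A] by (simp add: image_comp)
    moreover have "?T ` leg_box ` {..<b} = enumerate L ` {..<b}"
      unfolding image_image by (intro image_cong) (auto simp: leg)
    ultimately show ?thesis
      using image_enumerate[OF fin(2)] by (simp add: boxes_hook image_Un card_L hook_filling_simps)
  qed
  also have "insert 1 (A \<union> L) = {1..a + b + 1}"
    using A by (auto simp: L_def)
  finally have img: "?T ` boxes (hook a b) = {1..a + b + 1}" .
  \<comment> \<open>Surjectivity onto \<open>{1..a + b + 1}\<close> suffices for bijectivity, as there are no more boxes
     than entries.\<close>
  have "card (boxes (hook a b)) \<le> a + b + 1"
  proof -
    have "card (arm_box ` {..<a} \<union> leg_box ` {..<b}) \<le> a + b"
      using card_Un_le[of "arm_box ` {..<a}" "leg_box ` {..<b}"]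
        card_image_le[of "{..<a}" arm_box] card_image_le[of "{..<b}" leg_box] by simp
    then show ?thesis
      unfolding boxes_hook by (simp add: card_insert_if)
  qed
  then have "inj_on ?T (boxes (hook a b))"
    using card_image_le[of "boxes (hook a b)" ?T]
    by (intro eq_card_imp_inj_on) (simp_all add: img, simp_all add: boxes_hook)
  then have "bij_betw ?T (boxes (hook a b)) {1..a + b + 1}"
    using img by (simp add: bij_betw_def)
  moreover have "1 < x" if "x \<in> A \<or> x \<in> L" for x
    using that A by (auto simp: L_def)
  ultimately show ?thesis
    unfolding SYT_hook_iff
    using A card_L fin arm leg
    by (auto simp: hook_filling_simps(1) strict_mono_on_def finite_enumerate_mono)
      (simp add: hook_filling_def)
qed

text \<open>
  Conversely, the corner lies below all other boxes and so holds \<open>1\<close>. The leg then holds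
  exactly what the arm leaves of \<open>{2..a + b + 1}\<close>, and monotonicity fixes the order within
  each of the two.
\<close>

lemma SYT_hook_eq_filling:
  assumes T: "(hook a b, T) \<in> SYT (a + b + 1)"
  defines "A \<equiv> (T \<circ> arm_box) ` {..<a}"
  shows "A \<subseteq> {2..a + b + 1}" "card A = a" "T = hook_filling a b A"
proof -
  define L where "L = (T \<circ> leg_box) ` {..<b}"
  note * = T[unfolded SYT_hook_iff]
  have inj: "inj_on T (boxes (hook a b))" and img: "T ` boxes (hook a b) = {1..a + b + 1}"
    using * by (auto simp: bij_betw_def)
  have split: "insert (T (0, 0)) (A \<union> L) = {1..a + b + 1}"
    unfolding img[symmetric] boxes_hook A_def L_def by (simp add: image_Un image_comp)
  have above: "T (0, 0) < x" if "x \<in> A \<union> L" for x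
    using that * by (auto simp: A_def L_def)
  have corner: "T (0, 0) = 1"
  proof -
    have "1 \<in> insert (T (0, 0)) (A \<union> L)" "T (0, 0) \<ge> 1"
      using split by auto
    then show ?thesis
      using above[of 1] by auto
  qed
  show A: "A \<subseteq> {2..a + b + 1}"
    using split above corner by fastforce
  show "card A = a"
    unfolding A_def using * card_image[OF strict_mono_on_imp_inj_on[of "{..<a}" "T \<circ> arm_box"]]
    by simp
  have "A \<inter> L = {}"
  proof -
    have "A = T ` arm_box ` {..<a}" "L = T ` leg_box ` {..<b}"
      by (auto simp: A_def L_def)
    moreover have "arm_box ` {..<a} \<inter> leg_box ` {..<b} = {}"
      by (auto simp: arm_box_def leg_box_def)
    ultimately show ?thesis
      using inj_on_image_Int[OF inj, of "arm_box ` {..<a}" "leg_box ` {..<b}"]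
      by (auto simp: boxes_hook)
  qed
  moreover have "A \<union> L = {2..a + b + 1}"
  proof -
    have "A \<union> L = {1..a + b + 1} - {1}"
      using split above corner by fastforce
    also have "\<dots> = {2..a + b + 1}"
      by auto
    finally show ?thesis .
  qed
  ultimately have L: "L = {2..a + b + 1} - A"
    by blast
  have arm: "T (arm_box j) = enumerate A j" if "j < a" for j
    using enumerate_unique[of a "T \<circ> arm_box" j] * that by (simp add: A_def)
  have leg: "T (leg_box i) = enumerate L i" if "i < b" for i
    using enumerate_unique[of b "T \<circ> leg_box" i] * that by (simp add: L_def)
  show "T = hook_filling a b A"
  proof (rule extensionalityI[of _ "boxes (hook a b)"])
    show "T \<in> extensional (boxes (hook a b))"
      using * by simp
    show "hook_filling a b A \<in> extensional (boxes (hook a b))"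
      by (simp add: hook_filling_def)
    show "T x = hook_filling a b A x" if "x \<in> boxes (hook a b)" for x
      using that by (auto simp: boxes_hook hook_filling_simps corner arm leg L)
  qed
qed

section \<open>Counting hooks\<close>

text \<open>
  The size of a hook and the length of its first row determine the length of its leg, so the
  tableaux counted by \<open>hook_count\<close> all have the same shape.
\<close>

lemma hooks_with_first_row:
  "{(lam, T). (lam, T) \<in> hooks (a + b + 1) \<and> hd lam = Suc a} =
   Pair (hook a b) ` {T. (hook a b, T) \<in> SYT (a + b + 1)}"
proof -
  have "lam = hook a b"
    if "(lam, T) \<in> SYT (a + b + 1)" "hook_shape lam" "hd lam = Suc a" for lam T
    using that by (auto simp: hook_def hook_shape_def SYT_def partition_of_def sum_list_replicate)
  moreover have "hook_shape (hook a b)"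
    by (auto simp: hook_def hook_shape_def)
  moreover have "hd (hook a b) = Suc a"
    by (simp add: hook_def)
  ultimately show ?thesis
    unfolding hooks_def by fastforce
qed

theorem hook_count_eq_binomial: "hook_count (a + b + 1) (Suc a) = (a + b) choose a"
proof -
  let ?\<A> = "{A. A \<subseteq> {2..a + b + 1} \<and> card A = a}"
  let ?\<T> = "{T. (hook a b, T) \<in> SYT (a + b + 1)}"
  have "bij_betw (hook_filling a b) ?\<A> ?\<T>"
  proof (rule bij_betw_byWitness[where f' = "\<lambda>T. (T \<circ> arm_box) ` {..<a}"])
    show "\<forall>A\<in>?\<A>. (hook_filling a b A \<circ> arm_box) ` {..<a} = A"
      using hook_filling_arm by blast
    show "\<forall>T\<in>?\<T>. hook_filling a b ((T \<circ> arm_box) ` {..<a}) = T"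
      using SYT_hook_eq_filling(3) by (metis mem_Collect_eq)
    show "hook_filling a b ` ?\<A> \<subseteq> ?\<T>"
      using hook_filling_SYT by blast
    show "(\<lambda>T. (T \<circ> arm_box) ` {..<a}) ` ?\<T> \<subseteq> ?\<A>"
      using SYT_hook_eq_filling(1,2) by blast
  qed
  then have "card ?\<T> = card ?\<A>"
    by (simp add: bij_betw_same_card)
  also have "\<dots> = (a + b) choose a"
    by (simp add: n_subsets)
  finally show ?thesis
    by (simp only: hook_count_def hooks_with_first_row) (simp add: card_image inj_on_def)
qed

theorem theorem3p2:
  fixes n :: nat
  assumes "n \<ge> 1"
  shows "log_concave 1 n (\<lambda>k. real (hook_count n k))"
proof -
  have count: "hook_count n (Suc a) = (n - 1) choose a" if "Suc a \<le> n" for a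
    using that hook_count_eq_binomial[of a "n - Suc a"] by simp
  have "0 < hook_count n k" if "k \<in> {1..n}" for k
    using that count[of "k - 1"] by (auto simp: Suc_le_eq)
  moreover have "hook_count n (k - 1) * hook_count n (k + 1) \<le> (hook_count n k)\<^sup>2"
    if k: "k \<in> {1<..<n}" for k
  proof -
    obtain j where j: "k = Suc (Suc j)"
      using k by (metis greaterThanLessThan_iff less_iff_Suc_add One_nat_def add_Suc)
    then show ?thesis
      using k binomial_row_log_concave[of j "n - 1"] by (simp add: count)
  qed
  ultimately show ?thesis
    unfolding log_concave_def
    by (metis of_nat_0_less_iff of_nat_le_iff of_nat_mult of_nat_power)
qed

end
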